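(* Let $X$ be a smooth two-dimensional real Banach space. For each $u\in S_X$ let $b(u)$ be a chosen one of the two unit vectors in the kernel of the unique norming functional of $u$. Then $$\mathrm{DR}_B(X)=\sup_{u\in S_X}\ \sup_{\sigma\in\{-1,1\}}\ \sup_{t>0}\frac{\|u-\sigma b(u)\|}{\|tu-t^{-1}\sigma b(u)\|}.$$ If, in addition, $X$ is strictly convex, then the outer supremum may be taken over any closed half arc of $S_X$ (a closed arc meeting every antipodal pair $\{u,-u\}$ of $S_X$).
   Context: $S_X$ is the unit sphere of $X$. The norming functional of $u\in S_X$ is the functional $f\in S_{X^*}$ with $f(u)=1$, unique since $X$ is smooth. Birkhoff orthogonality: $x\perp_B y$ iff $\|x+\lambda y\|\ge\|x\|$ for all $\lambda\in\mathbb R$. For nonzero $x,y\in X$ put $\alpha[x,y]=\left\|\frac{x}{\|x\|}-\frac{y}{\|y\|}\right\|$ and $\beta[x,y]=\left\|\frac{x}{\|y\|}-\frac{y}{\|x\|}\right\|$, and $$\mathrm{DR}_B(X)=\sup\left\{\frac{\alpha[x,y]}{\beta[x,y]}: x,y\in X\setminus\{0\},\ x\perp_B y,\ \beta[x,y]\ne 0\right\}.$$ *)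

theory Defs
  imports "HOL-Analysis.Analysis"
begin

definition is_norming_functional :: "'a::real_normed_vector \<Rightarrow> ('a \<Rightarrow>\<^sub>L real) \<Rightarrow> bool"
  where "is_norming_functional u f \<longleftrightarrow> norm f = 1 \<and> blinfun_apply f u = 1"

definition smooth_space :: "'a::real_normed_vector itself \<Rightarrow> bool"
  where "smooth_space T \<longleftrightarrow>
    (\<forall>u\<in>sphere (0::'a) 1. \<exists>!f. is_norming_functional u f)"

text \<open>Only meaningful for unit vectors of a smooth space, where the functional is unique.\<close>

definition norming_functional :: "'a::real_normed_vector \<Rightarrow> ('a \<Rightarrow>\<^sub>L real)"
  where "norming_functional u = (THE f. is_norming_functional u f)"

definition strictly_convex_space :: "'a::real_normed_vector itself \<Rightarrow> bool"
  where "strictly_convex_space T \<longleftrightarrow>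
    (\<forall>x\<in>sphere (0::'a) 1. \<forall>y\<in>sphere 0 1. x \<noteq> y \<longrightarrow> norm (x + y) < 2)"

definition birkhoff_orthogonal :: "'a::real_normed_vector \<Rightarrow> 'a \<Rightarrow> bool"
  where "birkhoff_orthogonal x y \<longleftrightarrow> (\<forall>l::real. norm (x + l *\<^sub>R y) \<ge> norm x)"

definition ang_dist :: "'a::real_normed_vector \<Rightarrow> 'a \<Rightarrow> real"
  where "ang_dist x y = norm (x /\<^sub>R norm x - y /\<^sub>R norm y)"

definition skew_ang_dist :: "'a::real_normed_vector \<Rightarrow> 'a \<Rightarrow> real"
  where "skew_ang_dist x y = norm (x /\<^sub>R norm y - y /\<^sub>R norm x)"

text \<open>
  Suprema are taken in the extended reals, where they always exist, so that no
  boundedness convention is hidden in them; the quotients themselves are real.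
\<close>

definition DR_B :: "'a::real_normed_vector itself \<Rightarrow> ereal"
  where "DR_B T = Sup {ereal (ang_dist x y / skew_ang_dist x y) | x y :: 'a.
    x \<noteq> 0 \<and> y \<noteq> 0 \<and> birkhoff_orthogonal x y \<and> skew_ang_dist x y \<noteq> 0}"

text \<open>A closed arc is the image of an injective path on the closed unit interval.\<close>

definition closed_half_arc :: "'a::real_normed_vector set \<Rightarrow> bool"
  where "closed_half_arc C \<longleftrightarrow>
    (\<exists>g. arc g \<and> C = path_image g) \<and> C \<subseteq> sphere 0 1 \<and>
    (\<forall>u\<in>sphere 0 1. C \<inter> {u, - u} \<noteq> {})"

end

theory Submission
  imports Defs
begin

text \<open>
  In a smooth plane, the Birkhoff orthogonality of \<open>u\<close> to \<open>y \<noteq> 0\<close> makes the first coordinate with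
  respect to the basis \<open>u, y\<close> a norming functional of \<open>u\<close>, hence the one of \<open>u\<close>; so the unit
  vectors to which \<open>u\<close> is orthogonal are exactly \<open>\<plusminus>b u\<close>. Normalising \<open>x = \<parallel>x\<parallel>u\<close>, \<open>y = \<parallel>y\<parallel>v\<close> with
  \<open>t = \<parallel>x\<parallel> / \<parallel>y\<parallel>\<close> turns the quotient in the constant into the one of the theorem. The inner
  suprema are even in \<open>u\<close>, which allows one to pass to a half arc.
\<close>

section \<open>Scaling of orthogonal pairs and reduction to the unit sphere\<close>

text \<open>Ranging over all orthogonal unit vectors \<open>v\<close>, and not over multiples of
  \<open>b u\<close>, lets the reduction to the sphere and the antipodal symmetry be proved in any
  normed space.\<close>

definition orth_quotient_sup :: "'a::real_normed_vector \<Rightarrow> ereal"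
  where "orth_quotient_sup u =
    (SUP v\<in>{v \<in> sphere 0 1. birkhoff_orthogonal u v}. SUP t\<in>{0 :: real<..}.
       ereal (norm (u - v) / norm (t *\<^sub>R u - inverse t *\<^sub>R v)))"

text \<open>Homogeneous form of orthogonality, obtained by factoring out \<open>a\<close>. It gives
  invariance under scaling, keeps denominators away from zero, and bounds the first coordinate with
  respect to \<open>x, y\<close>.\<close>

lemma birkhoff_orthogonal_lower_bound:
  assumes "birkhoff_orthogonal x y"
  shows "\<bar>a\<bar> * norm x \<le> norm (a *\<^sub>R x + c *\<^sub>R y)"
proof (cases "a = 0")
  case False
  have "norm x \<le> norm (x + (c / a) *\<^sub>R y)"
    using assms unfolding birkhoff_orthogonal_def by blast
  then have "\<bar>a\<bar> * norm x \<le> \<bar>a\<bar> * norm (x + (c / a) *\<^sub>R y)"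
    by (simp add: mult_left_mono)
  also have "\<dots> = norm (a *\<^sub>R (x + (c / a) *\<^sub>R y))" by simp
  also have "a *\<^sub>R (x + (c / a) *\<^sub>R y) = a *\<^sub>R x + c *\<^sub>R y"
    using False by (simp add: scaleR_add_right)
  finally show ?thesis .
qed simp

lemma birkhoff_orthogonal_scaleR:
  assumes "birkhoff_orthogonal x y"
  shows "birkhoff_orthogonal (a *\<^sub>R x) (c *\<^sub>R y)"
  unfolding birkhoff_orthogonal_def
  using birkhoff_orthogonal_lower_bound[OF assms] by simp

lemma birkhoff_orthogonal_scaleR_iff:
  assumes "a \<noteq> 0" "c \<noteq> 0"
  shows "birkhoff_orthogonal (a *\<^sub>R x) (c *\<^sub>R y) \<longleftrightarrow> birkhoff_orthogonal x y"
  using birkhoff_orthogonal_scaleR[of "a *\<^sub>R x" "c *\<^sub>R y" "inverse a" "inverse c"]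
    birkhoff_orthogonal_scaleR[of x y a c] assms by auto

lemma ang_dist_scaleR:
  assumes "norm u = 1" "norm v = 1" "r > 0" "s > 0"
  shows "ang_dist (r *\<^sub>R u) (s *\<^sub>R v) = norm (u - v)"
  using assms by (simp add: ang_dist_def)

text \<open>The lengths enter through their ratio alone, which is why a single parameter
  \<open>t\<close> suffices.\<close>

lemma skew_ang_dist_scaleR:
  assumes "norm u = 1" "norm v = 1" "r > 0" "s > 0"
  shows "skew_ang_dist (r *\<^sub>R u) (s *\<^sub>R v) = norm ((r / s) *\<^sub>R u - inverse (r / s) *\<^sub>R v)"
proof -
  have "inverse s * r = r / s" "inverse r * s = inverse (r / s)"
    using assms by (simp_all add: field_simps)
  then show ?thesis using assms by (simp only: skew_ang_dist_def norm_scaleR scaleR_scaleR) simp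
qed

text \<open>Each admissible pair yields a triple \<open>u, v, t\<close> with the same quotient;
  conversely, a triple is realised by the pair \<open>t *\<^sub>R u\<close>,
  \<open>v\<close>.\<close>

lemma DR_B_eq_SUP_orth_quotient_sup:
  "DR_B TYPE('a::real_normed_vector) = (SUP u\<in>sphere (0::'a) 1. orth_quotient_sup u)"
proof (rule antisym)
  show "DR_B TYPE('a) \<le> (SUP u\<in>sphere (0::'a) 1. orth_quotient_sup u)"
    unfolding DR_B_def
  proof (rule Sup_least, clarify)
    fix x y :: 'a
    assume "x \<noteq> 0" "y \<noteq> 0" and orth: "birkhoff_orthogonal x y"
    define u v where "u = x /\<^sub>R norm x" and "v = y /\<^sub>R norm y"
    have unit: "norm u = 1" "norm v = 1"
      using \<open>x \<noteq> 0\<close> \<open>y \<noteq> 0\<close> by (auto simp: u_def v_def)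
    have xy: "x = norm x *\<^sub>R u" "y = norm y *\<^sub>R v"
      using \<open>x \<noteq> 0\<close> \<open>y \<noteq> 0\<close> by (auto simp: u_def v_def)
    have uv: "birkhoff_orthogonal u v"
      unfolding u_def v_def using orth by (rule birkhoff_orthogonal_scaleR)
    define t where "t = norm x / norm y"
    have t: "t > 0" using \<open>x \<noteq> 0\<close> \<open>y \<noteq> 0\<close> by (simp add: t_def)
    have pos: "norm x > 0" "norm y > 0" using \<open>x \<noteq> 0\<close> \<open>y \<noteq> 0\<close> by simp_all
    have "ang_dist x y = norm (u - v)"
      using ang_dist_scaleR[OF unit pos] unfolding xy[symmetric] .
    moreover have "skew_ang_dist x y = norm (t *\<^sub>R u - inverse t *\<^sub>R v)"
      using skew_ang_dist_scaleR[OF unit pos] unfolding xy[symmetric] t_def[symmetric] .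
    ultimately have "ang_dist x y / skew_ang_dist x y =
        norm (u - v) / norm (t *\<^sub>R u - inverse t *\<^sub>R v)"
      by (simp only:)
    also have "ereal \<dots> \<le> orth_quotient_sup u"
      unfolding orth_quotient_sup_def using unit uv t
      by (intro SUP_upper2[of v] SUP_upper) auto
    also have "\<dots> \<le> (SUP u\<in>sphere (0::'a) 1. orth_quotient_sup u)"
      using unit by (intro SUP_upper) auto
    finally show "ereal (ang_dist x y / skew_ang_dist x y) \<le> \<dots>" .
  qed
next
  show "(SUP u\<in>sphere (0::'a) 1. orth_quotient_sup u) \<le> DR_B TYPE('a)"
    unfolding orth_quotient_sup_def
  proof (intro SUP_least)
    fix u v :: 'a and t :: real
    assume "u \<in> sphere 0 1" "v \<in> {v \<in> sphere 0 1. birkhoff_orthogonal u v}" "t \<in> {0<..}"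
    then have unit: "norm u = 1" "norm v = 1" and uv: "birkhoff_orthogonal u v" and t: "t > 0"
      by auto
    \<comment> \<open>Orthogonality keeps the denominator at least \<open>t\<close>, so the side
      condition of \<open>DR_B\<close> that it be nonzero holds automatically.\<close>
    have "t \<le> norm (t *\<^sub>R u - inverse t *\<^sub>R v)"
      using birkhoff_orthogonal_lower_bound[OF uv, of t "- inverse t"] unit t by simp
    then have "skew_ang_dist (t *\<^sub>R u) v \<noteq> 0"
      using skew_ang_dist_scaleR[OF unit t, of 1] t by auto
    moreover have "birkhoff_orthogonal (t *\<^sub>R u) v"
      using birkhoff_orthogonal_scaleR[OF uv, of t 1] by simp
    moreover have "t *\<^sub>R u \<noteq> 0" "v \<noteq> 0" using unit t by auto
    ultimately have "ereal (ang_dist (t *\<^sub>R u) v / skew_ang_dist (t *\<^sub>R u) v) \<le> DR_B TYPE('a)"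
      unfolding DR_B_def by (intro Sup_upper) blast
    then show "ereal (norm (u - v) / norm (t *\<^sub>R u - inverse t *\<^sub>R v)) \<le> DR_B TYPE('a)"
      using ang_dist_scaleR[OF unit t, of 1] skew_ang_dist_scaleR[OF unit t, of 1] by simp
  qed
qed

section \<open>Antipodal symmetry and passage to half of the sphere\<close>

lemma orth_quotient_sup_minus: "orth_quotient_sup (- u) = orth_quotient_sup u"
proof -
  \<comment> \<open>Replacing \<open>v\<close> by \<open>- v\<close> flips the sign inside both
    norms. Proved for every \<open>u\<close>, the inequality gives its own converse at
    \<open>- u\<close>.\<close>
  have "orth_quotient_sup (- u) \<le> orth_quotient_sup u" for u :: 'a
    unfolding orth_quotient_sup_def
  proof (intro SUP_least)
    fix v :: 'a and t :: real
    assume "v \<in> {v \<in> sphere 0 1. birkhoff_orthogonal (- u) v}" and t: "t \<in> {0<..}"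
    then have v: "- v \<in> {v \<in> sphere 0 1. birkhoff_orthogonal u v}"
      using birkhoff_orthogonal_scaleR_iff[of "-1" "-1" "- u" v] by simp
    have "norm (- u - v) = norm (u - - v)"
      using norm_minus_cancel[of "u + v"] by (simp add: algebra_simps)
    moreover have "norm (t *\<^sub>R (- u) - inverse t *\<^sub>R v) = norm (t *\<^sub>R u - inverse t *\<^sub>R (- v))"
      using norm_minus_cancel[of "t *\<^sub>R u + inverse t *\<^sub>R v"] by (simp add: algebra_simps)
    ultimately show "ereal (norm (- u - v) / norm (t *\<^sub>R (- u) - inverse t *\<^sub>R v)) \<le>
        (SUP v\<in>{v \<in> sphere 0 1. birkhoff_orthogonal u v}. SUP t\<in>{0 :: real<..}.
           ereal (norm (u - v) / norm (t *\<^sub>R u - inverse t *\<^sub>R v)))"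
      using t by (intro SUP_upper2[OF v] SUP_upper2[OF t]) simp
  qed
  from this[of u] this[of "- u"] show ?thesis by simp
qed

lemma SUP_sphere_eq_SUP_half:
  fixes F :: "'a::real_normed_vector \<Rightarrow> 'b::complete_lattice"
  assumes even: "\<And>u. F (- u) = F u"
    and "C \<subseteq> sphere 0 1" "\<And>u. u \<in> sphere 0 1 \<Longrightarrow> C \<inter> {u, - u} \<noteq> {}"
  shows "(SUP u\<in>sphere 0 1. F u) = (SUP u\<in>C. F u)"
proof (rule antisym)
  show "(SUP u\<in>sphere 0 1. F u) \<le> (SUP u\<in>C. F u)"
  proof (rule SUP_mono)
    fix u :: 'a assume "u \<in> sphere 0 1"
    then have "u \<in> C \<or> - u \<in> C" using assms(3) by blast
    then show "\<exists>m\<in>C. F u \<le> F m" using eq_refl[OF even[of u, symmetric]] by blast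
  qed
qed (use assms(2) in \<open>rule SUP_subset_mono, simp_all\<close>)

section \<open>Linear algebra in the plane\<close>

lemma span_pair_eq_UNIV:
  fixes u y :: "'a::real_vector"
  assumes "dim (UNIV :: 'a set) = 2" "independent {u, y}" "u \<noteq> y"
  shows "span {u, y} = UNIV"
proof -
  obtain B :: "'a set" where B: "independent B" "UNIV \<subseteq> span B" "card B = 2"
    by (rule real_vector.basis_exists[of "UNIV :: 'a set"]) (simp add: assms(1))
  \<comment> \<open>Infinite sets have \<open>card\<close> equal to 0, so cardinality 2 forces
    finiteness.\<close>
  have "finite B" using B(3) by (simp add: card_ge_0_finite)
  have "x \<in> span {u, y}" for x
  \<comment> \<open>A vector outside the span would give three independent vectors in the span of
    the two-element set \<open>B\<close>.\<close>
  proof (rule ccontr)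
    assume x: "x \<notin> span {u, y}"
    then have "independent (insert x {u, y})"
      using assms(2) by (rule real_vector.independent_insertI)
    then have "card (insert x {u, y}) \<le> card B"
      using real_vector.independent_span_bound[OF \<open>finite B\<close>] B(2)
      by (metis subset_UNIV subset_trans)
    moreover have "x \<notin> {u, y}" using x real_vector.span_base[of x "{u, y}"] by metis
    ultimately show False using assms(3) B(3) by simp
  qed
  then show ?thesis by blast
qed

lemma in_span_pair_iff: "x \<in> span {u, y} \<longleftrightarrow> (\<exists>a c. x = a *\<^sub>R u + c *\<^sub>R y)"
proof -
  have "x \<in> span {u, y} \<longleftrightarrow> (\<exists>a c. x - a *\<^sub>R u = c *\<^sub>R y)"
    by (auto simp: real_vector.span_breakdown_eq[of x] real_vector.span_singleton)
  then show ?thesis by (simp add: diff_eq_eq add.commute)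
qed

lemma independent_pair_of_functional:
  fixes f :: "'a::real_vector \<Rightarrow> real"
  assumes "linear f" "f u \<noteq> 0" "f y = 0" "y \<noteq> 0"
  shows "independent {u, y}" "u \<noteq> y"
proof -
  have "f (c *\<^sub>R y) = 0" for c using assms by (simp add: linear_cmul)
  then have "u \<notin> span {y}" using assms(2) by (auto simp: real_vector.span_singleton)
  then show "independent {u, y}"
    using assms(4) by (simp add: real_vector.independent_insertI)
qed (use assms in auto)

section \<open>Norming functionals and orthogonality\<close>

lemma is_norming_functional_norming_functional:
  assumes "smooth_space TYPE('a::real_normed_vector)" "norm (u::'a) = 1"
  shows "is_norming_functional u (norming_functional u)"
  unfolding norming_functional_def
  by (rule theI') (use assms in \<open>simp add: smooth_space_def\<close>)

lemma norming_functional_eqI: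
  assumes "smooth_space TYPE('a::real_normed_vector)" "norm (u::'a) = 1"
    and "is_norming_functional u f"
  shows "norming_functional u = f"
  unfolding norming_functional_def
  by (rule the1_equality) (use assms in \<open>simp_all add: smooth_space_def\<close>)

text \<open>Moving along the kernel of \<open>f\<close> leaves the value 1 unchanged, and that value
  is a lower bound for the norm.\<close>

lemma birkhoff_orthogonal_if_norming_functional:
  assumes "is_norming_functional u f" "norm u = 1" "blinfun_apply f y = 0"
  shows "birkhoff_orthogonal u y"
  unfolding birkhoff_orthogonal_def
proof
  fix l :: real
  have "1 = blinfun_apply f (u + l *\<^sub>R y)"
    using assms by (simp add: is_norming_functional_def blinfun.bilinear_simps)
  also have "\<dots> \<le> norm (u + l *\<^sub>R y)"
    using norm_blinfun[of f "u + l *\<^sub>R y"] assms(1) by (simp add: is_norming_functional_def)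
  finally show "norm u \<le> norm (u + l *\<^sub>R y)" using assms(2) by simp
qed

text \<open>Since \<open>u, y\<close> is a basis, the coordinate functional is defined on the whole
  space, and no Hahn-Banach extension is involved.\<close>

lemma norming_functional_if_birkhoff_orthogonal:
  fixes u y :: "'a::real_normed_vector"
  assumes "dim (UNIV :: 'a set) = 2" "norm u = 1" "y \<noteq> 0" "birkhoff_orthogonal u y"
  obtains f where "is_norming_functional u f" "blinfun_apply f y = 0"
proof -
  note bound = birkhoff_orthogonal_lower_bound[OF assms(4)]
  \<comment> \<open>If \<open>u\<close> were this multiple of \<open>y\<close>, the bound would read
    1 \<le> 0.\<close>
  have "u \<noteq> c *\<^sub>R y" for c
    using bound[of 1 "- c"] assms(2) by auto
  then have "u \<notin> span {y}" by (auto simp: real_vector.span_singleton)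
  then have ind: "independent {u, y}" and "u \<noteq> y"
    using assms(3) real_vector.span_base[of y "{y}"]
    by (simp_all add: real_vector.independent_insertI, blast)
  have "\<exists>g. linear g \<and> (\<forall>x\<in>{u, y}. g x = (if x = u then 1 else 0 :: real))"
    using ind by (rule linear_independent_extend)
  then obtain g :: "'a \<Rightarrow> real" where g: "linear g" "g u = 1" "g y = 0"
    using \<open>u \<noteq> y\<close> by auto
  have le: "norm (g x) \<le> norm x * 1" for x
  proof -
    obtain a c where x: "x = a *\<^sub>R u + c *\<^sub>R y"
      using span_pair_eq_UNIV[OF assms(1) ind \<open>u \<noteq> y\<close>] in_span_pair_iff by blast
    have "g x = a" using g by (simp add: x linear_add linear_cmul)
    \<comment> \<open>Here \<open>bound\<close> says exactly that the first coordinate of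
      \<open>x\<close> is at most its norm in absolute value.\<close>
    then show ?thesis using bound[of a c] assms(2) x by simp
  qed
  have "bounded_linear g"
    using g(1) le by (intro bounded_linear.intro bounded_linear_axioms.intro) blast+
  then have apply_g: "blinfun_apply (Blinfun g) = g" by (rule bounded_linear_Blinfun_apply)
  have "norm (Blinfun g) \<le> 1" using le by (intro norm_blinfun_bound) (auto simp: apply_g)
  moreover have "1 \<le> norm (Blinfun g)"
    using norm_blinfun[of "Blinfun g" u] g assms(2) by (simp add: apply_g)
  ultimately show ?thesis
    using g by (intro that[of "Blinfun g"]) (auto simp: is_norming_functional_def apply_g)
qed

text \<open>Smoothness identifies the functional produced by orthogonality with
  \<open>norming_functional u\<close>. Its kernel is the line through \<open>w\<close>, which
  contains just two unit vectors.\<close>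

lemma orthogonal_unit_vectors:
  fixes u w :: "'a::real_normed_vector"
  assumes dim: "dim (UNIV :: 'a set) = 2" and smooth: "smooth_space TYPE('a)"
    and u: "norm u = 1" and w: "norm w = 1" "blinfun_apply (norming_functional u) w = 0"
  shows "{v \<in> sphere 0 1. birkhoff_orthogonal u v} = (\<lambda>\<sigma>. \<sigma> *\<^sub>R w) ` {-1, 1}"
proof -
  let ?f = "norming_functional u"
  have f: "is_norming_functional u ?f"
    using is_norming_functional_norming_functional[OF smooth u] .
  have "v = w \<or> v = - w" if v: "norm v = 1" "birkhoff_orthogonal u v" for v
  proof -
    have "v \<noteq> 0" using v by auto
    then obtain h where "is_norming_functional u h" "blinfun_apply h v = 0"
      using norming_functional_if_birkhoff_orthogonal[OF dim u _ v(2)] by blast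
    then have fv: "blinfun_apply ?f v = 0"
      using norming_functional_eqI[OF smooth u] by simp
    have fu: "blinfun_apply ?f u = 1" using f by (simp add: is_norming_functional_def)
    have "linear (blinfun_apply ?f)"
      by (simp add: blinfun.bounded_linear_right bounded_linear.linear)
    moreover have "w \<noteq> 0" using w(1) by auto
    ultimately have "independent {u, w}" "u \<noteq> w"
      using independent_pair_of_functional[of "blinfun_apply ?f" u w] fu w(2) by auto
    then obtain a c where vac: "v = a *\<^sub>R u + c *\<^sub>R w"
      using span_pair_eq_UNIV[OF dim] in_span_pair_iff by blast
    \<comment> \<open>The functional takes the value 0 at \<open>v\<close> and at \<open>w\<close>,
      and 1 at \<open>u\<close>, so applying it isolates \<open>a\<close>.\<close>
    then have "a = 0" using fv fu w by (simp add: blinfun.bilinear_simps)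
    then have "v = c *\<^sub>R w" "\<bar>c\<bar> = 1" using vac v w by auto
    then show ?thesis by (cases "c \<ge> 0") (auto simp: abs_if split: if_splits)
  qed
  moreover have "birkhoff_orthogonal u w"
    using birkhoff_orthogonal_if_norming_functional[OF f u w(2)] .
  then have "birkhoff_orthogonal u (- w)"
    using birkhoff_orthogonal_scaleR[of u w 1 "-1"] by simp
  ultimately show ?thesis using \<open>birkhoff_orthogonal u w\<close> w by auto
qed

theorem theorem4p1:
  fixes b :: "'a::banach \<Rightarrow> 'a"
  assumes "dim (UNIV :: 'a set) = 2"
    and "smooth_space TYPE('a)"
    and "\<And>u. u \<in> sphere 0 1 \<Longrightarrow>
           b u \<in> sphere 0 1 \<and> blinfun_apply (norming_functional u) (b u) = 0"
  shows "DR_B TYPE('a) =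
           (SUP u\<in>sphere 0 1. SUP \<sigma>\<in>{-1, 1 :: real}. SUP t\<in>{0 :: real<..}.
              ereal (norm (u - \<sigma> *\<^sub>R b u) / norm (t *\<^sub>R u - inverse t *\<^sub>R (\<sigma> *\<^sub>R b u))))
       \<and> (strictly_convex_space TYPE('a) \<longrightarrow>
           (\<forall>C :: 'a set. closed_half_arc C \<longrightarrow>
             DR_B TYPE('a) =
               (SUP u\<in>C. SUP \<sigma>\<in>{-1, 1 :: real}. SUP t\<in>{0 :: real<..}.
                  ereal (norm (u - \<sigma> *\<^sub>R b u) / norm (t *\<^sub>R u - inverse t *\<^sub>R (\<sigma> *\<^sub>R b u))))))"
proof -
  let ?G = "\<lambda>u. SUP \<sigma>\<in>{-1, 1 :: real}. SUP t\<in>{0 :: real<..}.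
              ereal (norm (u - \<sigma> *\<^sub>R b u) / norm (t *\<^sub>R u - inverse t *\<^sub>R (\<sigma> *\<^sub>R b u)))"
  \<comment> \<open>The orthogonal unit vectors are the image of the two signs, so the supremum over
    \<open>v\<close> becomes one over \<sigma>. This needs \<open>u\<close> on the sphere, where
    \<open>b\<close> is controlled.\<close>
  have G: "?G u = orth_quotient_sup u" if "u \<in> sphere 0 1" for u
    unfolding orth_quotient_sup_def
    using orthogonal_unit_vectors[OF assms(1,2), of u "b u"] assms(3)[OF that] that
    by (simp add: image_image)
  have "DR_B TYPE('a) = (SUP u\<in>sphere 0 1. ?G u)"
    unfolding DR_B_eq_SUP_orth_quotient_sup by (rule SUP_cong[OF refl]) (rule G[symmetric])
  moreover have "DR_B TYPE('a) = (SUP u\<in>C. ?G u)" if "closed_half_arc C" for C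
  proof -
    have C: "C \<subseteq> sphere 0 1" "\<And>u. u \<in> sphere 0 1 \<Longrightarrow> C \<inter> {u, - u} \<noteq> {}"
      using that by (auto simp: closed_half_arc_def)
    have "DR_B TYPE('a) = (SUP u\<in>C. orth_quotient_sup u)"
      unfolding DR_B_eq_SUP_orth_quotient_sup
      using orth_quotient_sup_minus C by (rule SUP_sphere_eq_SUP_half)
    also have "\<dots> = (SUP u\<in>C. ?G u)"
      using C(1) by (intro SUP_cong[OF refl] G[symmetric]) blast
    finally show ?thesis .
  qed
  ultimately show ?thesis by blast
qed

end
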